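(* Let $X\in L^0_d$ and regard $F^{\vartriangle}_{X,C}$ as a function from $\mathcal{G}(\mathbb{R}^d,C)$ to $[0,1]$ and $Q^-_{X,C}$ as a function from $[0,1]$ to $\mathcal{G}(\mathbb{R}^d,C)$. Then the following hold. (a) For every $D\in\mathcal{G}(\mathbb{R}^d,C)$ and every $p\in[0,1]$, $$Q^-_{X,C}(p)\supseteq D \quad\Longleftrightarrow\quad p\le F^{\vartriangle}_{X,C}(D).$$ (b) The two compositions $F^{\vartriangle}_{X,C}\circ Q^-_{X,C}\colon[0,1]\to[0,1]$ (with respect to the order $\le$ on $[0,1]$) and $Q^-_{X,C}\circ F^{\vartriangle}_{X,C}\colon\mathcal{G}(\mathbb{R}^d,C)\to\mathcal{G}(\mathbb{R}^d,C)$ (with respect to set inclusion $\subseteq$ on $\mathcal{G}(\mathbb{R}^d,C)$) are closure operators, i.e., extensive, increasing and idempotent. (c) The set $$\mathcal{F}_X(\mathbb{R}^d,C)=\{D\in\mathcal{G}(\mathbb{R}^d,C)\mid D=(Q^-_{X,C}\circ F^{\vartriangle}_{X,C})(D)\}$$ is a complete lattice with respect to $\supseteq$. (d) One has $$\forall p\in[0,1]\colon\quad Q^-_{X,C}(p)=\inf\{D\in\mathcal{G}(\mathbb{R}^d,C)\mid F^{\vartriangle}_{X,C}(D)\ge p\},$$ $$\forall D\in\mathcal{G}(\mathbb{R}^d,C)\colon\quad F^{\vartriangle}_{X,C}(D)=\sup\{p\in[0,1]\mid D\subseteq Q^-_{X,C}(p)\},$$ where the first infimum is taken in the complete lattice 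$(\mathcal{G}(\mathbb{R}^d,C),\supseteq)$.
   Context: Let $d\ge1$, let $(\Omega,\mathcal{A},\mathbb{P})$ be a probability space and let $L^0_d$ be the space of (equivalence classes of) random variables with values in $\mathbb{R}^d$. Let $C$ be a nonempty closed convex cone with $C\subsetneq\mathbb{R}^d$ (neither nonempty interior nor pointedness is assumed; $C=\{0\}$ is allowed). Its dual cone is $C^+=\{w\in\mathbb{R}^d\mid w^Tz\ge0\text{ for all }z\in C\}$. For $w\in\mathbb{R}^d\setminus\{0\}$ put $H^+(w)=\{z\in\mathbb{R}^d\mid w^Tz\ge0\}$. $\mathcal{G}(\mathbb{R}^d,C)=\{D\subseteq\mathbb{R}^d\mid D=\mathrm{cl}\,\mathrm{co}(D+C)\}$ (closed convex hull; Minkowski sum with $A+\emptyset=\emptyset+A=\emptyset$, so $\emptyset\in\mathcal{G}(\mathbb{R}^d,C)$). Ordered by $\supseteq$ (a larger set is a smaller element), it is a complete lattice in which, for $\mathcal{D}\subseteq\mathcal{G}(\mathbb{R}^d,C)$, $\inf\mathcal{D}=\mathrm{cl}\,\mathrm{co}\bigcup_{D\in\mathcal{D}}D$ and $\sup\mathcal{D}=\bigcap_{D\in\mathcal{D}}D$. For $X\in L^0_d$, $w\in\mathbb{R}^d\setminus\{0\}$, $z\in\mathbb{R}^d$: $F_{X,w}(z)=\mathbb{P}\{X\in z-H^+(w)\}=\mathbb{P}\{w^TX\le w^Tz\}$. The lower $C$-distribution function is $F_{X,C}(z)=\inf_{w\in C^+\setminus\{0\}}F_{X,w}(z)$. For $p\in[0,1]$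 the lower $C$-quantile is $Q^-_{X,C}(p)=\{z\in\mathbb{R}^d\mid F_{X,C}(z)\ge p\}$; it belongs to $\mathcal{G}(\mathbb{R}^d,C)$. For $D\in\mathcal{G}(\mathbb{R}^d,C)$, the inf-extension is $F^{\vartriangle}_{X,C}(D)=\inf_{z\in D}F_{X,C}(z)$, the infimum being taken in the complete lattice $[0,1]$, so that $F^{\vartriangle}_{X,C}(\emptyset)=1$. *)

theory Defs
  imports "HOL-Probability.Probability" "HOL-Algebra.Complete_Lattice"
begin

definition unit_lattice :: "real gorder" where
  "unit_lattice = \<lparr>carrier = {0..1}, eq = (=), le = (\<le>)\<rparr>"

abbreviation subset_order :: "'a set set \<Rightarrow> 'a set gorder" where
  "subset_order \<A> \<equiv> \<lparr>carrier = \<A>, eq = (=), le = (\<subseteq>)\<rparr>"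

abbreviation supset_order :: "'a set set \<Rightarrow> 'a set gorder" where
  "supset_order \<A> \<equiv> \<lparr>carrier = \<A>, eq = (=), le = (\<supseteq>)\<rparr>"

definition closure_operator :: "('a, 'm) gorder_scheme \<Rightarrow> ('a \<Rightarrow> 'a) \<Rightarrow> bool" where
  "closure_operator L f \<longleftrightarrow>
     f \<in> carrier L \<rightarrow> carrier L \<and>
     (\<forall>x\<in>carrier L. x \<sqsubseteq>\<^bsub>L\<^esub> f x) \<and>
     isotone L L f \<and>
     idempotent L f"

definition dual_cone :: "(real ^ 'd) set \<Rightarrow> (real ^ 'd) set" where
  "dual_cone C = {w. \<forall>z\<in>C. 0 \<le> w \<bullet> z}"

definition pos_halfspace :: "real ^ 'd \<Rightarrow> (real ^ 'd) set" where
  "pos_halfspace w = {z. 0 \<le> w \<bullet> z}"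

text \<open>Here \<open>+\<close> is the Minkowski sum, for which \<open>{} + C = {}\<close>; hence \<open>{}\<close> is a member.\<close>

definition cl_conv_sets :: "(real ^ 'd) set \<Rightarrow> (real ^ 'd) set set" where
  "cl_conv_sets C = {D. D = closure (convex hull (D + C))}"

definition scalar_cdf :: "'a measure \<Rightarrow> ('a \<Rightarrow> real ^ 'd) \<Rightarrow> real ^ 'd \<Rightarrow> real ^ 'd \<Rightarrow> real" where
  "scalar_cdf M X w z = measure M {\<omega> \<in> space M. X \<omega> \<in> (\<lambda>h. z - h) ` pos_halfspace w}"

text \<open>
  Infima and suprema of probabilities are those of the complete lattice \<open>[0,1]\<close>, so the infimum
  of the empty set is \<open>1\<close> (see \<open>unit_lattice_inf\<close> and \<open>unit_lattice_sup\<close> below).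
\<close>

definition lower_cdf ::
    "'a measure \<Rightarrow> ('a \<Rightarrow> real ^ 'd) \<Rightarrow> (real ^ 'd) set \<Rightarrow> real ^ 'd \<Rightarrow> real" where
  "lower_cdf M X C z = \<Sqinter>\<^bsub>unit_lattice\<^esub> ((\<lambda>w. scalar_cdf M X w z) ` (dual_cone C - {0}))"

definition lower_quantile ::
    "'a measure \<Rightarrow> ('a \<Rightarrow> real ^ 'd) \<Rightarrow> (real ^ 'd) set \<Rightarrow> real \<Rightarrow> (real ^ 'd) set" where
  "lower_quantile M X C p = {z. p \<le> lower_cdf M X C z}"

definition inf_extension ::
    "'a measure \<Rightarrow> ('a \<Rightarrow> real ^ 'd) \<Rightarrow> (real ^ 'd) set \<Rightarrow> (real ^ 'd) set \<Rightarrow> real" where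
  "inf_extension M X C D = \<Sqinter>\<^bsub>unit_lattice\<^esub> (lower_cdf M X C ` D)"

definition quantile_sets ::
    "'a measure \<Rightarrow> ('a \<Rightarrow> real ^ 'd) \<Rightarrow> (real ^ 'd) set \<Rightarrow> (real ^ 'd) set set" where
  "quantile_sets M X C =
     {D \<in> cl_conv_sets C. D = (lower_quantile M X C \<circ> inf_extension M X C) D}"

text \<open>
  The operators \<open>\<Sqinter>\<close> and \<open>\<Squnion>\<close> of HOL-Algebra choose some greatest lower or least upper bound.  The
  facts below show that in the two lattices used here these bounds exist, and compute them.
\<close>

lemma glb_imp_inf_eq:
  assumes "partial_order L" "is_glb L g A"
  shows "\<Sqinter>\<^bsub>L\<^esub> A = g"
proof -
  interpret partial_order L by fact
  have "is_glb L (\<Sqinter>\<^bsub>L\<^esub> A) A"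
    unfolding Lattice.inf_def using assms(2) by (rule someI)
  with assms(2) show ?thesis
    by (metis greatest_unique)
qed

lemma lub_imp_sup_eq:
  assumes "partial_order L" "is_lub L s A"
  shows "\<Squnion>\<^bsub>L\<^esub> A = s"
proof -
  interpret partial_order L by fact
  have "is_lub L (\<Squnion>\<^bsub>L\<^esub> A) A"
    unfolding Lattice.sup_def using assms(2) by (rule someI)
  with assms(2) show ?thesis
    by (metis least_unique)
qed

lemma partial_order_unit_lattice: "partial_order unit_lattice"
  by unfold_locales (auto simp: unit_lattice_def)

lemma unit_lattice_glb:
  assumes "A \<subseteq> {0..1}"
  shows "is_glb unit_lattice (if A = {} then 1 else Inf A) A"
proof (cases "A = {}")
  case True
  then show ?thesis
    by (auto simp: unit_lattice_def greatest_def Lower_def)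
next
  case False
  have bdd: "bdd_below A"
    using assms by (meson bdd_below_Icc bdd_below_mono)
  have "Inf A \<in> {0..1}"
    using False assms bdd cInf_lower2[of _ A 1] cInf_greatest[of A 0] by fastforce
  then show ?thesis
    using False assms bdd
    by (auto simp: unit_lattice_def greatest_def Lower_def
        intro!: cInf_lower cInf_greatest)
qed

lemma unit_lattice_lub:
  assumes "A \<subseteq> {0..1}"
  shows "is_lub unit_lattice (if A = {} then 0 else Sup A) A"
proof (cases "A = {}")
  case True
  then show ?thesis
    by (auto simp: unit_lattice_def least_def Upper_def)
next
  case False
  have bdd: "bdd_above A"
    using assms by (meson bdd_above_Icc bdd_above_mono)
  have "Sup A \<in> {0..1}"
    using False assms bdd cSup_upper2[of _ A 0] cSup_least[of A 1] by fastforce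
  then show ?thesis
    using False assms bdd
    by (auto simp: unit_lattice_def least_def Upper_def
        intro!: cSup_upper cSup_least)
qed

lemma complete_lattice_unit_lattice: "complete_lattice unit_lattice"
proof -
  interpret partial_order unit_lattice by (rule partial_order_unit_lattice)
  show ?thesis
    by (rule complete_latticeI)
      (use unit_lattice_glb unit_lattice_lub in \<open>auto simp: unit_lattice_def\<close>)
qed

lemma unit_lattice_inf:
  "A \<subseteq> {0..1} \<Longrightarrow> \<Sqinter>\<^bsub>unit_lattice\<^esub> A = (if A = {} then 1 else Inf A)"
  by (rule glb_imp_inf_eq[OF partial_order_unit_lattice unit_lattice_glb])

lemma unit_lattice_sup:
  "A \<subseteq> {0..1} \<Longrightarrow> \<Squnion>\<^bsub>unit_lattice\<^esub> A = (if A = {} then 0 else Sup A)"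
  by (rule lub_imp_sup_eq[OF partial_order_unit_lattice unit_lattice_lub])

lemma mem_cl_conv_sets_iff:
  fixes C :: "(real ^ 'd) set"
  assumes "C \<noteq> {}" "convex C" "cone C"
  shows "D \<in> cl_conv_sets C \<longleftrightarrow> closed D \<and> convex D \<and> D + C \<subseteq> D"
proof
  assume D: "D \<in> cl_conv_sets C"
  then have eq: "D = closure (convex hull (D + C))"
    by (simp add: cl_conv_sets_def)
  have "closed D" "convex D"
    by (subst eq, simp add: convex_closure)+
  moreover have "D + C \<subseteq> D"
    by (subst (2) eq) (meson closure_subset hull_subset order_trans)
  ultimately show "closed D \<and> convex D \<and> D + C \<subseteq> D" by simp
next
  assume D: "closed D \<and> convex D \<and> D + C \<subseteq> D"
  have "0 \<in> C"
    using assms by (simp add: cone_contains_0)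
  then have "D \<subseteq> D + C"
    by (metis add.right_neutral set_plus_intro subsetI)
  with D have "D + C = D" by blast
  with D show "D \<in> cl_conv_sets C"
    by (simp add: cl_conv_sets_def hull_same closure_closed)
qed

lemma partial_order_supset_order: "partial_order (supset_order \<A>)"
  by unfold_locales auto

lemma cl_conv_sets_glb:
  fixes C :: "(real ^ 'd) set"
  assumes C: "C \<noteq> {}" "convex C" "cone C" and \<D>: "\<D> \<subseteq> cl_conv_sets C"
  shows "is_glb (supset_order (cl_conv_sets C)) (closure (convex hull (\<Union>\<D>))) \<D>"
proof -
  note iff = mem_cl_conv_sets_iff[OF C]
  let ?U = "\<Union>\<D>"
  have U: "?U + C \<subseteq> ?U"
  proof
    fix x assume "x \<in> ?U + C"
    then obtain D a c where D: "D \<in> \<D>" "a \<in> D" "c \<in> C" "x = a + c"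
      by (auto elim!: set_plus_elim)
    then have "x \<in> D + C" by (simp add: set_plus_intro)
    with D \<D> show "x \<in> ?U" using iff by blast
  qed
  have "(convex hull ?U) + C = convex hull (?U + C)"
    using C by (simp add: convex_hull_set_plus hull_same)
  also have "\<dots> \<subseteq> convex hull ?U"
    using U by (rule hull_mono)
  finally have hull: "(convex hull ?U) + C \<subseteq> convex hull ?U" .
  have "closure (convex hull ?U) + C \<subseteq> closure (convex hull ?U)"
  proof
    fix x assume "x \<in> closure (convex hull ?U) + C"
    then obtain a c where a: "a \<in> closure (convex hull ?U)" and c: "c \<in> C" and x: "x = c + a"
      by (auto elim!: set_plus_elim simp: add.commute)
    have "(\<lambda>y. c + y) ` (convex hull ?U) \<subseteq> convex hull ?U"
      using hull c by (auto simp: add.commute intro: set_plus_intro)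
    moreover have "x \<in> closure ((\<lambda>y. c + y) ` (convex hull ?U))"
      unfolding closure_translation x using a by (rule imageI)
    ultimately show "x \<in> closure (convex hull ?U)"
      using closure_mono by blast
  qed
  then have mem: "closure (convex hull ?U) \<in> cl_conv_sets C"
    unfolding iff by (intro conjI closed_closure convex_closure convex_convex_hull)
  have sub: "D \<subseteq> closure (convex hull ?U)" if "D \<in> \<D>" for D
    using that by (meson Union_upper closure_subset hull_subset order_trans)
  have least: "closure (convex hull ?U) \<subseteq> E"
    if "E \<in> cl_conv_sets C" "\<And>D. D \<in> \<D> \<Longrightarrow> D \<subseteq> E" for E
  proof -
    have "?U \<subseteq> E" using that(2) by (rule Union_least)
    moreover have "convex E" "closed E" using that(1) by (simp_all add: iff)
    ultimately show ?thesis by (intro closure_minimal hull_minimal)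
  qed
  show ?thesis
    unfolding greatest_def
  proof (intro conjI ballI)
    show "closure (convex hull ?U) \<in> Lower (supset_order (cl_conv_sets C)) \<D>"
      using mem sub by (simp add: Lower_def)
    fix E assume "E \<in> Lower (supset_order (cl_conv_sets C)) \<D>"
    then have "E \<in> cl_conv_sets C" "\<And>D. D \<in> \<D> \<Longrightarrow> D \<subseteq> E"
      using \<D> by (auto simp: Lower_def)
    then show "E \<sqsubseteq>\<^bsub>supset_order (cl_conv_sets C)\<^esub> closure (convex hull ?U)"
      using least by simp
  qed (simp add: Lower_def)
qed

lemma cl_conv_sets_lub:
  fixes C :: "(real ^ 'd) set"
  assumes C: "C \<noteq> {}" "convex C" "cone C" and \<D>: "\<D> \<subseteq> cl_conv_sets C"
  shows "is_lub (supset_order (cl_conv_sets C)) (\<Inter>\<D>) \<D>"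
proof -
  note iff = mem_cl_conv_sets_iff[OF C]
  have "\<Inter>\<D> + C \<subseteq> \<Inter>\<D>"
  proof
    fix x assume "x \<in> \<Inter>\<D> + C"
    then obtain a c where a: "\<forall>D\<in>\<D>. a \<in> D" and c: "c \<in> C" and x: "x = a + c"
      by (auto elim!: set_plus_elim)
    show "x \<in> \<Inter>\<D>"
    proof
      fix D assume "D \<in> \<D>"
      with a c x have "x \<in> D + C" by (simp add: set_plus_intro)
      with \<open>D \<in> \<D>\<close> \<D> show "x \<in> D" using iff by blast
    qed
  qed
  moreover have "closed (\<Inter>\<D>)" "convex (\<Inter>\<D>)"
    using \<D> iff by (auto intro!: closed_Inter convex_Inter)
  ultimately have "\<Inter>\<D> \<in> cl_conv_sets C" by (simp add: iff)
  moreover have "E \<subseteq> \<Inter>\<D>" if "E \<in> Upper (supset_order (cl_conv_sets C)) \<D>" for E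
    using that \<D> by (auto simp: Upper_def)
  ultimately show ?thesis
    by (simp add: least_def Upper_def Inter_lower)
qed

lemma complete_lattice_cl_conv_sets:
  fixes C :: "(real ^ 'd) set"
  assumes "C \<noteq> {}" "convex C" "cone C"
  shows "complete_lattice (supset_order (cl_conv_sets C))"
proof -
  interpret partial_order "supset_order (cl_conv_sets C)"
    by (rule partial_order_supset_order)
  show ?thesis
    by (rule complete_latticeI) (simp_all, (blast intro: cl_conv_sets_glb[OF assms] cl_conv_sets_lub[OF assms])+)
qed

lemma cl_conv_sets_inf:
  fixes C :: "(real ^ 'd) set"
  assumes "C \<noteq> {}" "convex C" "cone C" "\<D> \<subseteq> cl_conv_sets C"
  shows "\<Sqinter>\<^bsub>supset_order (cl_conv_sets C)\<^esub> \<D> = closure (convex hull (\<Union>\<D>))"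
  by (rule glb_imp_inf_eq[OF partial_order_supset_order cl_conv_sets_glb[OF assms]])

lemma cl_conv_sets_sup:
  fixes C :: "(real ^ 'd) set"
  assumes "C \<noteq> {}" "convex C" "cone C" "\<D> \<subseteq> cl_conv_sets C"
  shows "\<Squnion>\<^bsub>supset_order (cl_conv_sets C)\<^esub> \<D> = \<Inter>\<D>"
  by (rule lub_imp_sup_eq[OF partial_order_supset_order cl_conv_sets_lub[OF assms]])

end

theory Submission
  imports Defs "HOL-Algebra.Galois_Connection"
begin

text \<open>
  The equivalence \<open>D \<subseteq> Q p \<longleftrightarrow> p \<le> F D\<close> says that \<open>Q\<close> is the lower and \<open>F\<close> the upper
  adjoint of a Galois connection between \<open>([0,1], \<le>)\<close> and the closed convex \<open>C\<close>-upward sets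
  ordered by \<open>\<supseteq>\<close>.  It is almost immediate: both sides say that \<open>p\<close> is a lower bound of
  the values on \<open>D\<close> of the lower distribution function (\<open>le_inf_extension_iff\<close>).  All other
  claims are then the order theory of adjoint pairs between complete lattices: the compositions
  are a closure and a kernel operator, the fixed points of the latter are a complete lattice by
  Knaster--Tarski, and each adjoint is recovered from the other by an infimum or a supremum.  A
  kernel operator for \<open>\<supseteq>\<close> is a closure operator for \<open>\<subseteq>\<close>.

  Analysis enters at a single point: \<open>Q p\<close> has to be closed, convex and stable under adding \<open>C\<close>
  (\<open>lower_quantile_mem_cl_conv_sets\<close>).  It is the intersection, over nonzero \<open>w\<close> in the dual cone, of
  the preimages under \<open>z \<mapsto> w \<bullet> z\<close> of the superlevel sets \<open>{t. p \<le> G\<^sub>w t}\<close>, where \<open>G\<^sub>w\<close> is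
  the distribution function of \<open>w \<bullet> X\<close>.  Such a superlevel set is an up-set of the line,
  because \<open>G\<^sub>w\<close> is monotone, hence convex, and it is closed because \<open>G\<^sub>w\<close> is
  right-continuous.
\<close>

text \<open>
  The complement is open: by right-continuity \<open>cdf M t < p\<close> persists slightly to the right of \<open>t\<close>,
  and by monotonicity it holds everywhere to the left.
\<close>

lemma (in finite_borel_measure) closed_cdf_superlevel: "closed {t. p \<le> cdf M t}"
proof -
  have "\<exists>e>0. \<forall>y. dist y t < e \<longrightarrow> y \<in> - {t. p \<le> cdf M t}" if "cdf M t < p" for t
  proof -
    have "(cdf M \<longlongrightarrow> cdf M t) (at_right t)"
      using cdf_is_right_cont by (simp add: continuous_within)
    then have "\<forall>\<^sub>F y in at_right t. cdf M y < p"
      using that by (rule order_tendstoD)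
    then obtain b where b: "t < b" "\<And>y. t < y \<Longrightarrow> y < b \<Longrightarrow> cdf M y < p"
      by (auto simp: eventually_at_right_field)
    have "cdf M y < p" if "y < b" for y
      using b that \<open>cdf M t < p\<close> cdf_nondecreasing[of y t] by (cases "t < y") auto
    then show ?thesis
      using b(1) by (intro exI[of _ "b - t"]) (auto simp: dist_real_def not_le)
  qed
  then have "open (- {t. p \<le> cdf M t})"
    unfolding open_dist by (auto simp: not_le)
  then show ?thesis by (simp add: closed_def)
qed

lemma (in finite_borel_measure) convex_cdf_superlevel: "convex {t. p \<le> cdf M t}"
  unfolding is_interval_convex_1[symmetric] is_interval_1
  using cdf_nondecreasing order_trans by blast

lemma scalar_cdf_eq_cdf:
  assumes "X \<in> borel_measurable M"
  shows "scalar_cdf M X w z = cdf (distr M borel (\<lambda>\<omega>. w \<bullet> X \<omega>)) (w \<bullet> z)"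
proof -
  have "x \<in> (\<lambda>h. z - h) ` pos_halfspace w \<longleftrightarrow> w \<bullet> x \<le> w \<bullet> z" for x
    by (auto simp: pos_halfspace_def inner_diff_right intro!: image_eqI[of _ _ "z - x"])
  then show ?thesis
    using assms by (simp add: scalar_cdf_def cdf_def measure_distr vimage_def Int_def conj_commute)
qed

text \<open>
  The bound \<open>p \<le> 1\<close> is there for empty \<open>A\<close>, whose infimum in \<open>[0,1]\<close> is \<open>1\<close>.  The empty case
  does occur: \<open>D = {}\<close> belongs to the lattice of sets.
\<close>

lemma le_unit_lattice_inf_iff:
  assumes "A \<subseteq> {0..1}" "p \<le> 1"
  shows "p \<le> \<Sqinter>\<^bsub>unit_lattice\<^esub> A \<longleftrightarrow> (\<forall>a\<in>A. p \<le> a)"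
proof (cases "A = {}")
  case False
  have "bdd_below A"
    using assms(1) by (meson bdd_below_Icc bdd_below_mono)
  with False assms(1) show ?thesis
    by (simp add: unit_lattice_inf le_cInf_iff)
qed (use assms in \<open>simp add: unit_lattice_inf\<close>)

lemma unit_lattice_inf_mem:
  assumes "A \<subseteq> {0..1}"
  shows "\<Sqinter>\<^bsub>unit_lattice\<^esub> A \<in> {0..1}"
proof -
  interpret complete_lattice unit_lattice by (rule complete_lattice_unit_lattice)
  show ?thesis
    using weak.inf_closed[of A] assms by (simp add: unit_lattice_def)
qed

context
  fixes M :: "'a measure" and X :: "'a \<Rightarrow> real ^ 'd" and C :: "(real ^ 'd) set"
  assumes M: "prob_space M" and X: "X \<in> borel_measurable M"
begin

interpretation prob_space M by (rule M)

lemma scalar_cdf_mem: "scalar_cdf M X w z \<in> {0..1}"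
  by (simp add: scalar_cdf_def)

lemma lower_cdf_mem: "lower_cdf M X C z \<in> {0..1}"
  unfolding lower_cdf_def using scalar_cdf_mem by (blast intro: unit_lattice_inf_mem)

lemma inf_extension_mem: "inf_extension M X C D \<in> {0..1}"
  unfolding inf_extension_def using lower_cdf_mem by (blast intro: unit_lattice_inf_mem)

text \<open>
  The adjunction: being at most an infimum is a pointwise condition, so \<open>p \<le> F D\<close> is
  checked at each \<open>z \<in> D\<close> separately, where it is membership of \<open>z\<close> in the quantile.
\<close>

lemma le_inf_extension_iff:
  assumes "p \<le> 1"
  shows "p \<le> inf_extension M X C D \<longleftrightarrow> D \<subseteq> lower_quantile M X C p"
  unfolding inf_extension_def lower_quantile_def
  using lower_cdf_mem assms by (subst le_unit_lattice_inf_iff) blast+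

text \<open>
  This replaces the vector-valued condition by conditions on real distribution functions,
  one for each direction \<open>w\<close>.
\<close>

lemma lower_quantile_eq_INT:
  assumes "p \<le> 1"
  shows "lower_quantile M X C p = (\<Inter>w\<in>dual_cone C - {0}.
    (\<lambda>z. w \<bullet> z) -` {t. p \<le> cdf (distr M borel (\<lambda>\<omega>. w \<bullet> X \<omega>)) t})"
proof -
  have "p \<le> lower_cdf M X C z \<longleftrightarrow> (\<forall>w\<in>dual_cone C - {0}. p \<le> scalar_cdf M X w z)" for z
    unfolding lower_cdf_def
    using scalar_cdf_mem assms by (subst le_unit_lattice_inf_iff) blast+
  then show ?thesis
    by (auto simp: lower_quantile_def scalar_cdf_eq_cdf[OF X])
qed

lemma lower_quantile_mem_cl_conv_sets:
  assumes C: "C \<noteq> {}" "convex C" "cone C" and p: "p \<le> 1"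
  shows "lower_quantile M X C p \<in> cl_conv_sets C"
proof -
  have fbm: "finite_borel_measure (distr M borel (\<lambda>\<omega>. w \<bullet> X \<omega>))" for w
    by (intro real_distribution.finite_borel_measure_M real_distribution_distr
        borel_measurable_inner borel_measurable_const X)
  note eq = lower_quantile_eq_INT[OF p]
  have "closed (lower_quantile M X C p)"
    unfolding eq by (intro closed_INT ballI closed_vimage continuous_intros
        finite_borel_measure.closed_cdf_superlevel[OF fbm])
  moreover have "convex (lower_quantile M X C p)"
    unfolding eq by (intro convex_INT convex_linear_vimage
        finite_borel_measure.convex_cdf_superlevel[OF fbm]
        bounded_linear.linear bounded_linear_inner_right)
  moreover have "lower_quantile M X C p + C \<subseteq> lower_quantile M X C p"
  proof
    fix x assume "x \<in> lower_quantile M X C p + C"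
    then obtain z c where z: "z \<in> lower_quantile M X C p" and "c \<in> C" and "x = z + c"
      by (auto elim!: set_plus_elim)
    (* Only w in the dual cone enter the intersection, and for those a shift by an element
       of C can only increase w \<bullet> z. *)
    then have "w \<bullet> z \<le> w \<bullet> x" if "w \<in> dual_cone C" for w
      using that by (simp add: dual_cone_def inner_add_right)
    with z show "x \<in> lower_quantile M X C p"
      unfolding eq
      by (auto intro: order_trans[OF _ finite_borel_measure.cdf_nondecreasing[OF fbm]])
  qed
  ultimately show ?thesis
    by (simp add: mem_cl_conv_sets_iff[OF C])
qed

text \<open>
  The lattice of sets is taken with \<open>\<supseteq>\<close>: since \<open>p \<le> p'\<close> makes quantiles shrink, this is the
  order in which both adjoints are increasing.
\<close>

lemma galois_connection_quantile:
  assumes C: "C \<noteq> {}" "convex C" "cone C"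
  shows "galois_connection \<lparr>orderA = unit_lattice, orderB = supset_order (cl_conv_sets C),
    lower = lower_quantile M X C, upper = inf_extension M X C\<rparr>"
  by (intro galois_connection.intro connection.intro galois_connection_axioms.intro)
    (use lower_quantile_mem_cl_conv_sets[OF C] inf_extension_mem le_inf_extension_iff
      partial_order_unit_lattice partial_order_supset_order in \<open>auto simp: unit_lattice_def\<close>)

end

lemma (in galois_connection) closure_operator_upper_lower:
  "closure_operator \<X> (\<pi>\<^sub>* \<circ> \<pi>\<^sup>*)"
  unfolding closure_operator_def
  using inflation gf_iso adjoint_idem2 lower_closed upper_closed by auto

text \<open>
  Isotonicity and idempotence do not distinguish an order from its converse; only extensivity
  has to be supplied for \<open>\<subseteq>\<close>.
\<close>

lemma closure_operator_converse:
  assumes "f \<in> \<A> \<rightarrow> \<A>" "\<And>D. D \<in> \<A> \<Longrightarrow> D \<subseteq> f D"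
    and "isotone (supset_order \<A>) (supset_order \<A>) f" "idempotent (supset_order \<A>) f"
  shows "closure_operator (subset_order \<A>) f"
proof -
  have "weak_partial_order (subset_order \<A>)" by unfold_locales auto
  with assms show ?thesis
    by (auto simp: closure_operator_def isotone_def idempotent_def)
qed

text \<open>
  The fixed points of an idempotent map are its values, so the form of the Knaster--Tarski theorem
  for the image of an idempotent isotone map applies.
\<close>

lemma complete_lattice_fixed_points:
  assumes "complete_lattice L" "f \<in> carrier L \<rightarrow> carrier L" "isotone L L f" "idempotent L f"
  shows "complete_lattice (L\<lparr>carrier := {x \<in> carrier L. x = f x}\<rparr>)"
proof -
  interpret complete_lattice L by fact
  have "{x \<in> carrier L. x = f x} = f ` carrier L"
    using assms(2,4) by (fastforce simp: idempotent_def eq_is_equal)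
  then show ?thesis
    using Knaster_Tarski_idem[OF assms] by simp
qed

theorem proposition5:
  fixes M :: "'a measure" and X :: "'a \<Rightarrow> real ^ 'd" and C :: "(real ^ 'd) set"
  assumes "prob_space M"
    and "X \<in> borel_measurable M"
    and "C \<noteq> {}" and "closed C" and "convex C" and "cone C" and "C \<noteq> UNIV"
  defines "\<G> \<equiv> cl_conv_sets C"
    and "F \<equiv> inf_extension M X C"
    and "Q \<equiv> lower_quantile M X C"
  shows "F \<in> \<G> \<rightarrow> {0..1} \<and> Q \<in> {0..1} \<rightarrow> \<G>
    \<and> (\<forall>D\<in>\<G>. \<forall>p\<in>{0..1}. Q p \<supseteq> D \<longleftrightarrow> p \<le> F D)
    \<and> closure_operator unit_lattice (F \<circ> Q)
    \<and> closure_operator (subset_order \<G>) (Q \<circ> F)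
    \<and> complete_lattice (supset_order (quantile_sets M X C))
    \<and> (\<forall>p\<in>{0..1}. Q p = \<Sqinter>\<^bsub>supset_order \<G>\<^esub> {D \<in> \<G>. F D \<ge> p})
    \<and> (\<forall>D\<in>\<G>. F D = \<Squnion>\<^bsub>unit_lattice\<^esub> {p \<in> {0..1}. D \<subseteq> Q p})"
proof -
  note MX = assms(1,2) and C = \<open>C \<noteq> {}\<close> \<open>convex C\<close> \<open>cone C\<close>
  let ?U = unit_lattice and ?L = "supset_order \<G>"
  let ?K = "\<lparr>orderA = ?U, orderB = ?L, lower = Q, upper = F\<rparr>"
  interpret galois_connection ?K
    unfolding \<G>_def F_def Q_def by (rule galois_connection_quantile[OF MX C])
  have carrier_unit: "carrier ?U = {0..1}" "le ?U = (\<le>)"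
    by (simp_all add: unit_lattice_def)
  have G: "complete_lattice ?L"
    unfolding \<G>_def by (rule complete_lattice_cl_conv_sets[OF C])
  have F: "F \<in> \<G> \<rightarrow> {0..1}" and Q: "Q \<in> {0..1} \<rightarrow> \<G>"
    using upper_closure lower_closure by (simp_all add: carrier_unit)
  have QF: "Q \<circ> F \<in> carrier ?L \<rightarrow> carrier ?L" "isotone ?L ?L (Q \<circ> F)" "idempotent ?L (Q \<circ> F)"
    using F Q fg_iso adjoint_idem1 by auto
  have "D \<subseteq> Q p \<longleftrightarrow> p \<le> F D" if "D \<in> \<G>" "p \<in> {0..1}" for D p
    using galois_property[of p D] that by (simp add: carrier_unit)
  moreover have "closure_operator ?U (F \<circ> Q)"
    using closure_operator_upper_lower by simp
  moreover have "closure_operator (subset_order \<G>) (Q \<circ> F)"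
    using QF deflation by (intro closure_operator_converse) auto
  moreover have "complete_lattice (supset_order (quantile_sets M X C))"
    using complete_lattice_fixed_points[OF G QF]
    by (simp add: quantile_sets_def \<G>_def F_def Q_def)
  moreover have "Q p = \<Sqinter>\<^bsub>?L\<^esub> {D \<in> \<G>. F D \<ge> p}" if "p \<in> {0..1}" for p
    using lower_by_complete_lattice[of p] G that by (simp add: carrier_unit)
  moreover have "F D = \<Squnion>\<^bsub>?U\<^esub> {p \<in> {0..1}. D \<subseteq> Q p}" if "D \<in> \<G>" for D
    using upper_by_complete_lattice[of D] complete_lattice_unit_lattice that
    by (simp add: carrier_unit)
  ultimately show ?thesis
    using F Q by blast
qed

end
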